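(* Let $k,m$ be integers with $3\le k<m$. Then $$2\le \chi(mk,k)\le 3+\left\lceil\frac{(m-k)\cdot k}{k-1}\right\rceil.$$
   Context: For positive integers $k,N,d$ with $k\ge 3$, a $k$-term cyclic arithmetic progression mod $N$ with common difference $d$ is a $k$-element subset of $\mathbb{Z}_N=\mathbb{Z}/N\mathbb{Z}$ of the form $\{t,t+d,\ldots,t+(k-1)d\}$ for some $t\in\mathbb{Z}_N$ (so these $k$ elements are pairwise distinct mod $N$). $\chi(N,k)$ denotes the minimum number of subsets necessary to partition $\mathbb{Z}_N$ such that no subset in the partition contains any $k$-term cyclic arithmetic progression mod $N$. *)

theory Defs
  imports Complex_Main "HOL-Library.Disjoint_Sets"
begin

text \<open>The residue ring of integers modulo N is represented by its standard
  representatives \<open>{..<N}\<close>, with addition taken modulo N.\<close>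

text \<open>The cardinality condition says that the k terms are pairwise distinct modulo N.\<close>

definition cyclic_ap :: "nat \<Rightarrow> nat \<Rightarrow> nat \<Rightarrow> nat set \<Rightarrow> bool" where
  "cyclic_ap N k d S \<longleftrightarrow>
     card S = k \<and> (\<exists>t\<in>{..<N}. S = (\<lambda>i. (t + i * d) mod N) ` {..<k})"

definition cyclic_ap_free :: "nat \<Rightarrow> nat \<Rightarrow> nat set \<Rightarrow> bool" where
  "cyclic_ap_free N k B \<longleftrightarrow> \<not> (\<exists>d>0. \<exists>S\<subseteq>B. cyclic_ap N k d S)"

text \<open>For \<open>k \<ge> 2\<close> and \<open>N > 0\<close> the minimum is over a nonempty set, since the partition into
  singletons is admissible.\<close>

definition cyclic_vdw_chi :: "nat \<Rightarrow> nat \<Rightarrow> nat" where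
  "cyclic_vdw_chi N k =
     (LEAST r. \<exists>P. partition_on {..<N} P \<and> card P = r \<and> (\<forall>B\<in>P. cyclic_ap_free N k B))"

end

theory Submission
  imports Defs "HOL-Library.FuncSet" "HOL-Number_Theory.Cong"
begin

text \<open>
  Write \<open>N = m k\<close>, \<open>e = m - k\<close> and let \<open>q\<close> be the ceiling in the bound; then \<open>q > e\<close>. There are at
  most \<open>N (N - 1)\<close> progressions, each monochromatic for a fraction \<open>c\<^sup>1\<^sup>-\<^sup>k\<close> of all colourings with
  \<open>c\<close> colours. Since \<open>N\<^sup>2 \<le> (4 + e)\<^sup>k\<^sup>-\<^sup>1\<close> unless \<open>k \<le> 4\<close> or \<open>(k, e) = (5, 1)\<close>, counting gives a good
  colouring with \<open>3 + q\<close> colours except in these cases. There one colours the first \<open>k (k - 1) + 1\<close>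
  residues in alternating blocks of length \<open>k - 1\<close> with two colours and cuts the remaining
  \<open>e k + k - 1\<close> residues into at most \<open>q + 1\<close> classes with fewer than \<open>k\<close> elements. If
  \<open>N \<ge> 2 k (k - 1) + 1\<close>, a progression inside the first part cannot wrap around, so only finitely
  many moduli need to be inspected.
\<close>

section \<open>Progressions and colourings\<close>

text \<open>Reducing the difference modulo \<open>N\<close> keeps every term, and two distinct terms
  force a nonzero residue. This leaves \<open>N (N - 1)\<close> pairs \<open>(t, d')\<close> to
  count.\<close>

lemma cyclic_apE:
  assumes "cyclic_ap N k d S" and "2 \<le> k"
  obtains t d' where "t < N" "0 < d'" "d' < N" "S = (\<lambda>i. (t + i * d') mod N) ` {..<k}"
    "inj_on (\<lambda>i. (t + i * d') mod N) {..<k}"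
proof -
  from assms obtain t where t: "t < N" and S: "S = (\<lambda>i. (t + i * d) mod N) ` {..<k}"
    and card: "card S = k"
    by (auto simp: cyclic_ap_def)
  have *: "(\<lambda>i. (t + i * d) mod N) = (\<lambda>i. (t + i * (d mod N)) mod N)"
    by (intro ext mod_add_cong) (auto simp: mod_mult_right_eq)
  have inj: "inj_on (\<lambda>i. (t + i * (d mod N)) mod N) {..<k}"
    using card unfolding S * by (intro eq_card_imp_inj_on) simp_all
  have "d mod N \<noteq> 0"
  proof
    assume "d mod N = 0"
    then show False
      using inj_onD[OF inj, of 0 1] assms(2) by simp
  qed
  then show ?thesis
    using that[of t "d mod N"] t S inj unfolding * by simp
qed

lemma cyclic_ap_free_if_card_less:
  assumes "finite B" and "card B < k"
  shows "cyclic_ap_free N k B"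
  unfolding cyclic_ap_free_def
proof (intro notI, elim exE conjE)
  fix d S assume "S \<subseteq> B" and "cyclic_ap N k d S"
  then have "k \<le> card B"
    using card_mono[OF assms(1)] unfolding cyclic_ap_def by blast
  then show False
    using assms(2) by simp
qed

lemma cyclic_vdw_chi_le_coloring:
  assumes range: "f ` {..<N} \<subseteq> {..<r}"
    and free: "\<And>j. j < r \<Longrightarrow> cyclic_ap_free N k {x \<in> {..<N}. f x = j}"
  shows "cyclic_vdw_chi N k \<le> r"
proof -
  \<comment> \<open>Indexing by the colours actually used keeps the empty set out of the
    partition.\<close>
  define P where "P = (\<lambda>j. {x \<in> {..<N}. f x = j}) ` (f ` {..<N})"
  have "partition_on {..<N} P"
    by (rule partition_onI) (auto simp: P_def disjnt_def)
  moreover have "\<forall>B\<in>P. cyclic_ap_free N k B"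
    using range free by (auto simp: P_def)
  ultimately have "cyclic_vdw_chi N k \<le> card P"
    unfolding cyclic_vdw_chi_def by (intro Least_le) auto
  also have "\<dots> \<le> card (f ` {..<N})"
    unfolding P_def by (intro card_image_le) simp
  also have "\<dots> \<le> card {..<r}"
    using range by (intro card_mono) auto
  finally show ?thesis by simp
qed

lemma cyclic_vdw_chi_ge_2:
  assumes "2 \<le> k" and "k \<le> N"
  shows "2 \<le> cyclic_vdw_chi N k"
proof -
  let ?Q = "\<lambda>r. \<exists>P. partition_on {..<N} P \<and> card P = r \<and> (\<forall>B\<in>P. cyclic_ap_free N k B)"
  \<comment> \<open>The partition into singletons is admissible, so the minimum is attained by some
    \<open>P\<close>.\<close>
  have "\<forall>B\<in>(\<lambda>x. {x}) ` {..<N}. cyclic_ap_free N k B"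
    using assms by (auto intro!: cyclic_ap_free_if_card_less)
  then have "?Q (card ((\<lambda>x. {x}) ` {..<N}))"
    using partition_on_singletons by blast
  then have "?Q (cyclic_vdw_chi N k)"
    unfolding cyclic_vdw_chi_def by (rule LeastI)
  then obtain P where part: "partition_on {..<N} P" and card: "card P = cyclic_vdw_chi N k"
    and free: "\<forall>B\<in>P. cyclic_ap_free N k B"
    by blast
  have Un: "\<Union>P = {..<N}"
    using partition_onD1[OF part] by simp
  have "finite P"
    using finite_elements[OF _ part] by simp
  moreover have "P \<noteq> {}"
    using Un assms by (metis Union_empty lessThan_eq_iff lessThan_0 le_zero_eq not_numeral_le_zero)
  moreover have "card P \<noteq> 1"
  proof
    assume "card P = 1"
    then have free_all: "cyclic_ap_free N k {..<N}"
      using Un free by (auto simp: card_1_singleton_iff)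
    have "(\<lambda>i. (0 + i * 1) mod N) ` {..<k} = {..<k}"
      using assms by (auto simp: image_iff)
    then have "cyclic_ap N k 1 {..<k}"
      using assms by (auto simp: cyclic_ap_def intro!: bexI[of _ 0])
    moreover have "{..<k} \<subseteq> {..<N}"
      using assms by auto
    ultimately show False
      using free_all by (auto simp: cyclic_ap_free_def)
  qed
  ultimately show ?thesis
    using card card_gt_0_iff[of P] by linarith
qed

section \<open>The counting argument\<close>

text \<open>The value at \<open>s\<close> fixes all values on \<open>S\<close>, so restricting to
  the complement of \<open>S - {s}\<close> is injective.\<close>

lemma card_colorings_constant_on_le:
  assumes "finite V" and "S \<subseteq> V" and "s \<in> S"
  shows "card {f \<in> V \<rightarrow>\<^sub>E {..<c}. \<forall>x\<in>S. f x = f s} \<le> c ^ (card V - (card S - 1))"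
proof -
  let ?W = "V - (S - {s})"
  let ?A = "{f \<in> V \<rightarrow>\<^sub>E {..<c::nat}. \<forall>x\<in>S. f x = f s}"
  have inj: "inj_on (\<lambda>f. restrict f ?W) ?A"
  proof (rule inj_onI)
    fix f g assume f: "f \<in> ?A" and g: "g \<in> ?A" and eq: "restrict f ?W = restrict g ?W"
    have on_W: "f x = g x" if "x \<in> ?W" for x
      using fun_cong[OF eq, of x] that by simp
    show "f = g"
    proof (rule PiE_ext)
      show "f \<in> V \<rightarrow>\<^sub>E {..<c}" "g \<in> V \<rightarrow>\<^sub>E {..<c}"
        using f g by auto
      fix x assume "x \<in> V"
      show "f x = g x"
      proof (cases "x \<in> S")
        case True
        then have "f x = f s" "g x = g s"
          using f g by auto
        then show ?thesis
          using on_W[of s] assms by auto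
      qed (use on_W \<open>x \<in> V\<close> in auto)
    qed
  qed
  have "finite (?W \<rightarrow>\<^sub>E {..<c})"
    using assms by (intro finite_PiE) auto
  moreover have "(\<lambda>f. restrict f ?W) ` ?A \<subseteq> ?W \<rightarrow>\<^sub>E {..<c}"
    by (intro image_subsetI) (simp only: restrict_PiE_iff, auto)
  ultimately have "card ?A \<le> card (?W \<rightarrow>\<^sub>E {..<c})"
    using card_inj_on_le[OF inj] by blast
  also have "\<dots> = c ^ card ?W"
    using assms by (simp add: card_PiE)
  also have "card ?W = card V - (card S - 1)"
    using assms finite_subset[of S V] by (subst card_Diff_subset) auto
  finally show ?thesis .
qed

text \<open>Union bound over the sets \<open>bad S\<close> of colourings constant on
  \<open>S\<close>.\<close>

lemma ex_coloring_without_monochromatic: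
  fixes c k :: nat
  assumes "finite V" and "0 < c" and "0 < k"
    and sub: "\<And>S. S \<in> F \<Longrightarrow> S \<subseteq> V \<and> card S = k"
    and few: "card F < c ^ (k - 1)"
  shows "\<exists>f\<in>V \<rightarrow> {..<c}. \<forall>S\<in>F. \<nexists>j. \<forall>x\<in>S. f x = j"
proof -
  let ?T = "V \<rightarrow>\<^sub>E {..<c}"
  define bad where "bad S = {f \<in> ?T. \<exists>j. \<forall>x\<in>S. f x = j}" for S
  have finF: "finite F"
    using finite_subset[of F "Pow V"] assms by auto
  have finT: "finite ?T"
    using assms by (intro finite_PiE) auto
  have cardT: "card ?T = c ^ card V"
    using assms by (simp add: card_PiE)
  have bad_le: "card (bad S) \<le> c ^ (card V - (k - 1))" if S: "S \<in> F" for S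
  proof -
    obtain s where s: "s \<in> S"
      using sub[OF S] \<open>0 < k\<close> by (cases "S = {}") auto
    then have "bad S = {f \<in> ?T. \<forall>x\<in>S. f x = f s}"
      by (auto simp: bad_def)
    then show ?thesis
      using card_colorings_constant_on_le[of V S s c] sub[OF S] s \<open>finite V\<close> by simp
  qed
  have "card (\<Union>(bad ` F)) < card ?T"
  \<comment> \<open>A member of \<open>F\<close> is what gives \<open>k \<le> card V\<close>,
    without which the exponent \<open>card V - (k - 1)\<close> could be truncated.\<close>
  proof (cases "F = {}")
    case True
    then show ?thesis
      using cardT \<open>0 < c\<close> by simp
  next
    case False
    then have "k \<le> card V"
      using sub card_mono[OF \<open>finite V\<close>] by blast
    have "card (\<Union>(bad ` F)) \<le> (\<Sum>S\<in>F. card (bad S))"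
      using finF by (rule card_UN_le)
    also have "\<dots> \<le> card F * c ^ (card V - (k - 1))"
      using sum_bounded_above[of F "\<lambda>S. card (bad S)"] bad_le by simp
    also have "\<dots> < c ^ (k - 1) * c ^ (card V - (k - 1))"
      using few \<open>0 < c\<close> by simp
    also have "\<dots> = c ^ card V"
      using \<open>k \<le> card V\<close> by (simp flip: power_add)
    finally show ?thesis
      using cardT by simp
  qed
  moreover have "finite (\<Union>(bad ` F))"
    using finF finT by (auto simp: bad_def)
  ultimately have "\<not> ?T \<subseteq> \<Union>(bad ` F)"
    using card_mono by (metis linorder_not_less)
  then obtain f where "f \<in> ?T" "f \<notin> \<Union>(bad ` F)"
    by blast
  then show ?thesis
    by (intro bexI[of _ f]) (auto simp: bad_def PiE_def)
qed

lemma cyclic_vdw_chi_le_counting: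
  assumes "2 \<le> k" and "0 < N" and "0 < c" and le: "N ^ 2 \<le> c ^ (k - 1)"
  shows "cyclic_vdw_chi N k \<le> c"
proof -
  define F where "F = {S. S \<subseteq> {..<N} \<and> (\<exists>d. cyclic_ap N k d S)}"
  have "F \<subseteq> (\<lambda>(t, d). (\<lambda>i. (t + i * d) mod N) ` {..<k}) ` ({..<N} \<times> {0<..<N})"
  proof
    fix S assume "S \<in> F"
    then obtain d where "cyclic_ap N k d S"
      by (auto simp: F_def)
    then show "S \<in> (\<lambda>(t, d). (\<lambda>i. (t + i * d) mod N) ` {..<k}) ` ({..<N} \<times> {0<..<N})"
      using \<open>2 \<le> k\<close> by (elim cyclic_apE) force+
  qed
  then have "card F \<le> card ({..<N} \<times> {0<..<N})"
    by (meson finite_SigmaI finite_lessThan finite_greaterThanLessThan surj_card_le)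
  also have "\<dots> = N * (N - 1)"
    by (simp add: card_cartesian_product)
  also have "\<dots> < N ^ 2"
    using \<open>0 < N\<close> by (simp add: power2_eq_square)
  finally have "card F < c ^ (k - 1)"
    using le by linarith
  then obtain f where f: "f \<in> {..<N} \<rightarrow> {..<c}" "\<forall>S\<in>F. \<nexists>j. \<forall>x\<in>S. f x = j"
    using ex_coloring_without_monochromatic[of "{..<N}" c k F] assms
    by (auto simp: F_def cyclic_ap_def)
  show ?thesis
  proof (rule cyclic_vdw_chi_le_coloring)
    show "f ` {..<N} \<subseteq> {..<c}"
      using f(1) by auto
    show "cyclic_ap_free N k {x \<in> {..<N}. f x = j}" for j
      unfolding cyclic_ap_free_def
    proof (intro notI, elim exE conjE)
      fix d S assume S: "S \<subseteq> {x \<in> {..<N}. f x = j}" and "cyclic_ap N k d S"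
      then have "S \<in> F"
        unfolding F_def by blast
      moreover have "\<forall>x\<in>S. f x = j"
        using S by blast
      ultimately show False
        using f(2) by blast
    qed
  qed
qed

text \<open>With \<open>c = 4 + e\<close> the left side is the square of
  \<open>N = k (k + e)\<close>. As \<open>k\<close> grows by 1, it grows by a factor of at most
  16/9, the right side by \<open>c \<ge> 5\<close>.\<close>

lemma square_le_power:
  fixes k c :: nat
  assumes "6 \<le> k" and "5 \<le> c"
  shows "(k * (k - 4 + c)) ^ 2 \<le> c ^ (k - 1)"
  using assms(1)
proof (induction k rule: dec_induct)
  case base
  \<comment> \<open>The factor 42/5 suffices because its square is below 125, hence below
    \<open>c ^ 3\<close>.\<close>
  have "5 * (6 * (2 + c)) \<le> 42 * c"
    using assms(2) by simp
  then have "(5 * (6 * (2 + c))) ^ 2 \<le> (42 * c) ^ 2"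
    by (rule power_mono) simp
  then have "(6 * (2 + c)) ^ 2 \<le> 125 * c ^ 2"
    unfolding power_mult_distrib[of 5] power_mult_distrib[of 42] by simp
  also have "\<dots> \<le> c ^ 3 * c ^ 2"
    using power_mono[OF assms(2), of 3] by (intro mult_right_mono) auto
  finally show ?case
    by (simp flip: power_add)
next
  case (step k)
  have "3 * (Suc k * (Suc k - 4 + c)) \<le> 4 * (k * (k - 4 + c))"
  proof -
    \<comment> \<open>The ratios 7/6 and 8/7 multiply to 4/3; they use \<open>k \<ge> 6\<close> and
      \<open>k - 4 + c \<ge> 7\<close>.\<close>
    have "6 * Suc k \<le> 7 * k" "7 * (Suc k - 4 + c) \<le> 8 * (k - 4 + c)"
      using step assms(2) by auto
    then have "(6 * Suc k) * (7 * (Suc k - 4 + c)) \<le> (7 * k) * (8 * (k - 4 + c))"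
      by (rule mult_mono) auto
    then show ?thesis by (simp add: algebra_simps)
  qed
  then have "(3 * (Suc k * (Suc k - 4 + c))) ^ 2 \<le> (4 * (k * (k - 4 + c))) ^ 2"
    by (rule power_mono) simp
  then have "(Suc k * (Suc k - 4 + c)) ^ 2 \<le> 5 * (k * (k - 4 + c)) ^ 2"
    unfolding power_mult_distrib[of 3] power_mult_distrib[of 4] by simp
  also have "\<dots> \<le> c * c ^ (k - 1)"
    using step assms(2) by (intro mult_mono) auto
  also have "\<dots> = c ^ (Suc k - 1)"
    using step by (simp flip: power_Suc)
  finally show ?case .
qed

text \<open>This is the case \<open>k = 5\<close>, \<open>e = c - 4 \<ge> 2\<close>. At
  \<open>c = 5\<close> the estimate fails, as 900 > 625.\<close>

lemma square_le_power_5: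
  fixes c :: nat
  assumes "6 \<le> c"
  shows "(5 * (1 + c)) ^ 2 \<le> c ^ 4"
proof -
  have "6 * c \<le> c * c"
    using assms by (rule mult_right_mono) simp
  then have "5 * (1 + c) \<le> c ^ 2"
    using assms unfolding power2_eq_square by presburger
  then have "(5 * (1 + c)) ^ 2 \<le> (c ^ 2) ^ 2"
    by (rule power_mono) simp
  then show ?thesis
    by (simp flip: power_mult)
qed

section \<open>Alternating blocks\<close>

text \<open>\<open>mod_run M L s j n a b\<close>: in the progression modulo \<open>M\<close> with first terms \<open>a\<close>, \<open>b\<close>, the
  terms number 0 to \<open>n\<close> lie below \<open>L\<close> in blocks of length \<open>s\<close> whose index has parity \<open>j\<close>.\<close>

primrec mod_run :: "nat \<Rightarrow> nat \<Rightarrow> nat \<Rightarrow> nat \<Rightarrow> nat \<Rightarrow> nat \<Rightarrow> nat \<Rightarrow> bool" where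
  "mod_run M L s j 0 a b \<longleftrightarrow> a < L \<and> a div s mod 2 = j"
| "mod_run M L s j (Suc n) a b \<longleftrightarrow>
     a < L \<and> a div s mod 2 = j \<and> mod_run M L s j n b ((2 * b + M - a) mod M)"

lemma mod_runI:
  assumes "\<And>i. i \<le> n \<Longrightarrow> x i < L \<and> x i div s mod 2 = j"
    and "\<And>i. i + 2 \<le> n \<Longrightarrow> (2 * x (i + 1) + M - x i) mod M = x (i + 2)"
  shows "mod_run M L s j n (x 0) (x 1)"
  using assms
proof (induction n arbitrary: x)
  case (Suc n)
  have "mod_run M L s j n (x 1) (x 2)"
    using Suc.IH[of "\<lambda>i. x (i + 1)"] Suc.prems(1) Suc.prems(2)[of "_ + 1"]
    by (simp add: numeral_2_eq_2)
  then show ?case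
    using Suc.prems(1)[of 0] Suc.prems(1)[of 1] Suc.prems(2)[of 0]
    by (cases n) (auto simp: numeral_2_eq_2)
qed simp

text \<open>A finite test, since two terms determine a progression. The exempted pairs repeat a
  value among the first three terms. The argument \<open>k - 1\<close> is the index of the last of
  \<open>k\<close> terms.\<close>

definition run_free :: "nat \<Rightarrow> nat \<Rightarrow> bool" where
  "run_free k M \<longleftrightarrow> list_all (\<lambda>a. list_all (\<lambda>b. a = b \<or> (2 * b + M - a) mod M = a \<or>
     \<not> mod_run M (k * (k - 1) + 1) (k - 1) (a div (k - 1) mod 2) (k - 1) a b)
     [0..<k * (k - 1) + 1]) [0..<k * (k - 1) + 1]"

text \<open>The conditionals make the simplifier stop at the first term outside the class.\<close>

lemma mod_run_numeral:
  "mod_run M L s j (numeral n) a b \<longleftrightarrow>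
     (if a < L
      then if a div s mod 2 = j
        then mod_run M L s j (pred_numeral n) b ((2 * b + M - a) mod M) else False
      else False)"
  by (simp add: numeral_eq_Suc)

lemma upt_numeral: "[a..<numeral n] = (if a < numeral n then a # [Suc a..<numeral n] else [])"
  by (simp add: upt_rec)

text \<open>The moduli 12, 20, 24 and 30 are values of \<open>N\<close> itself; 13 and 25 are
  \<open>2 k (k - 1) + 1\<close> for \<open>k = 3, 4\<close> and stand for all larger
  \<open>N\<close>.\<close>

lemma run_free_small:
  "run_free 3 12" "run_free 3 13" "run_free 4 20" "run_free 4 24" "run_free 4 25" "run_free 5 30"
  unfolding run_free_def by (simp_all add: upt_numeral mod_run_numeral del: upt_Suc)

text \<open>Brings the three-term relation into the form computed by \<open>mod_run\<close>; adding
  \<open>M\<close> first prevents truncated subtraction.\<close>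

lemma cong_imp_mod_eq:
  fixes a b c M :: nat
  assumes "[c + a = 2 * b] (mod M)" and "a < M" and "c < M"
  shows "(2 * b + M - a) mod M = c"
proof -
  have "[2 * b + M - a + a = c + a] (mod M)"
    using assms by (simp add: cong_def)
  then have "[2 * b + M - a = c] (mod M)"
    by (simp add: cong_add_rcancel_nat)
  then show ?thesis
    using assms by (simp add: cong_def)
qed

text \<open>Consecutive terms satisfy the three-term recurrence modulo \<open>M\<close>, so a
  progression in the class would be a run excluded by \<open>run_free\<close>.\<close>

lemma alternating_blocks_ap_free:
  assumes "3 \<le> k" and free: "run_free k M"
    and M: "M = N \<or> M = 2 * (k * (k - 1)) + 1 \<and> M \<le> N"
  shows "cyclic_ap_free N k {x \<in> {..<N}. x < k * (k - 1) + 1 \<and> x div (k - 1) mod 2 = j}"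
    (is "cyclic_ap_free N k ?B")
  unfolding cyclic_ap_free_def
proof (intro notI, elim exE conjE)
  fix d S assume S: "S \<subseteq> ?B" and "cyclic_ap N k d S"
  then obtain t d' where S_eq: "S = (\<lambda>i. (t + i * d') mod N) ` {..<k}"
    and inj: "inj_on (\<lambda>i. (t + i * d') mod N) {..<k}"
    using \<open>3 \<le> k\<close> by (elim cyclic_apE) auto
  define x where "x i = (t + i * d') mod N" for i
  have xB: "x i \<in> ?B" if "i < k" for i
    using S S_eq that by (auto simp: x_def)
  have cong: "[x (i + 2) + x i = 2 * x (i + 1)] (mod N)" for i
  proof -
    have "[x (i + 2) + x i = (t + (i + 2) * d') + (t + i * d')] (mod N)"
      by (simp add: x_def cong_add)
    also have "(t + (i + 2) * d') + (t + i * d') = 2 * (t + (i + 1) * d')"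
      by (simp add: algebra_simps)
    also have "[\<dots> = 2 * x (i + 1)] (mod N)"
      unfolding x_def by (intro cong_mult cong_refl) (simp add: cong_def)
    finally show ?thesis .
  qed
  have rec: "(2 * x (i + 1) + M - x i) mod M = x (i + 2)" if "i + 2 < k" for i
  proof (rule cong_imp_mod_eq)
    have x: "x i \<in> ?B" "x (i + 1) \<in> ?B" "x (i + 2) \<in> ?B"
      using xB that by auto
    show "[x (i + 2) + x i = 2 * x (i + 1)] (mod M)"
      using M
    proof
      \<comment> \<open>All terms are at most \<open>k (k - 1)\<close>, so both sides of the
        congruence stay below \<open>N\<close>. It is then an equality and holds modulo
        \<open>M\<close> too.\<close>
      assume *: "M = 2 * (k * (k - 1)) + 1 \<and> M \<le> N"
      then have "x (i + 2) + x i < N" "2 * x (i + 1) < N"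
        using x by auto
      then show ?thesis
        using cong[of i] by (simp add: cong_def)
    qed (use cong in simp)
    show "x i < M" "x (i + 2) < M"
      using M x by auto
  qed
  have "x 0 \<noteq> x 1" "x 2 \<noteq> x 0"
    using inj_onD[OF inj, of 0 1] inj_onD[OF inj, of 2 0] \<open>3 \<le> k\<close> by (auto simp: x_def)
  moreover have "mod_run M (k * (k - 1) + 1) (k - 1) (x 0 div (k - 1) mod 2) (k - 1) (x 0) (x 1)"
  proof (rule mod_runI)
    show "x i < k * (k - 1) + 1 \<and> x i div (k - 1) mod 2 = x 0 div (k - 1) mod 2" if "i \<le> k - 1" for i
      using xB[of i] xB[of 0] that \<open>3 \<le> k\<close> by auto
    show "(2 * x (i + 1) + M - x i) mod M = x (i + 2)" if "i + 2 \<le> k - 1" for i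
      using rec[of i] that \<open>3 \<le> k\<close> by auto
  qed
  moreover have "(2 * x 1 + M - x 0) mod M = x 2"
    using rec[of 0] \<open>3 \<le> k\<close> by (simp add: numeral_2_eq_2)
  moreover have "x 0 \<in> set [0..<k * (k - 1) + 1]" "x 1 \<in> set [0..<k * (k - 1) + 1]"
    using xB[of 0] xB[of 1] \<open>3 \<le> k\<close> by auto
  ultimately show False
    using free unfolding run_free_def list_all_iff by metis
qed

text \<open>Colours 0 and 1 alternate on the first part; the rest is cut into \<open>q\<close>
  intervals of length at most \<open>k - 1\<close>, too short for \<open>k\<close> terms.\<close>

lemma cyclic_vdw_chi_le_blocks:
  assumes "3 \<le> k" and "run_free k M"
    and "M = N \<or> M = 2 * (k * (k - 1)) + 1 \<and> M \<le> N"
    and N: "N \<le> k * (k - 1) + 1 + q * (k - 1)"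
  shows "cyclic_vdw_chi N k \<le> 2 + q"
proof -
  define L where "L = k * (k - 1) + 1"
  define f where "f x = (if x < L then x div (k - 1) mod 2 else 2 + (x - L) div (k - 1))" for x
  show ?thesis
  proof (rule cyclic_vdw_chi_le_coloring)
    have "f x < 2 + q" if "x < N" for x
    proof (cases "x < L")
      case True
      then show ?thesis
        by (simp add: f_def trans_less_add1)
    next
      case False
      then have "x - L < q * (k - 1)"
        using \<open>x < N\<close> N by (simp add: L_def)
      then have "(x - L) div (k - 1) < q"
        by (rule less_mult_imp_div_less)
      then show ?thesis
        using False by (simp add: f_def)
    qed
    then show "f ` {..<N} \<subseteq> {..<2 + q}"
      by auto
    show "cyclic_ap_free N k {x \<in> {..<N}. f x = j}" for j
    proof (cases "j < 2")
      case True
      then have "{x \<in> {..<N}. f x = j} = {x \<in> {..<N}. x < L \<and> x div (k - 1) mod 2 = j}"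
        by (auto simp: f_def)
      then show ?thesis
        using alternating_blocks_ap_free[OF assms(1-3)] by (simp add: L_def)
    next
      case False
      let ?l = "L + (j - 2) * (k - 1)"
      have "{x \<in> {..<N}. f x = j} \<subseteq> {?l..<?l + (k - 1)}"
      proof
        fix x assume x: "x \<in> {x \<in> {..<N}. f x = j}"
        have "\<not> x < L"
        proof
          assume "x < L"
          then have "f x < 2"
            by (simp add: f_def)
          then show False
            using x False by simp
        qed
        then have "(x - L) div (k - 1) = j - 2"
          using x by (auto simp: f_def)
        then have "x = ?l + (x - L) mod (k - 1)"
          using div_mult_mod_eq[of "x - L" "k - 1"] \<open>\<not> x < L\<close>
          by (metis add.assoc le_add_diff_inverse linorder_not_less)
        moreover have "(x - L) mod (k - 1) < k - 1"
          using \<open>3 \<le> k\<close> by (intro mod_less_divisor) simp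
        ultimately show "x \<in> {?l..<?l + (k - 1)}"
          unfolding atLeastLessThan_iff by linarith
      qed
      from card_mono[OF _ this] have "card {x \<in> {..<N}. f x = j} < k"
        using \<open>3 \<le> k\<close> by simp
      then show ?thesis
        by (intro cyclic_ap_free_if_card_less) auto
    qed
  qed
qed

section \<open>The upper bound\<close>

lemma cyclic_vdw_chi_upper:
  assumes "3 \<le> k" and "0 < e" and q: "e * k \<le> q * (k - 1)"
  shows "cyclic_vdw_chi ((k + e) * k) k \<le> 3 + q"
proof -
  \<comment> \<open>Needed to pass from the counting bound with \<open>4 + e\<close> colours to
    \<open>3 + q\<close>.\<close>
  have "e < q"
  proof (rule ccontr)
    assume "\<not> e < q"
    then have "q * (k - 1) \<le> e * (k - 1)"
      by simp
    also have "\<dots> < e * k"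
      using assms by simp
    finally show False
      using q by simp
  qed
  have blocks: "cyclic_vdw_chi ((k + e) * k) k \<le> 3 + q"
    if "run_free k M" "M = (k + e) * k \<or> M = 2 * (k * (k - 1)) + 1 \<and> M \<le> (k + e) * k" for M
  proof -
    obtain l where k: "k = Suc l"
      using \<open>3 \<le> k\<close> by (cases k) auto
    \<comment> \<open>Past the first part there remain \<open>e k + k - 1\<close> residues, and
      \<open>e k \<le> q (k - 1)\<close>; hence \<open>q + 1\<close> further colours.\<close>
    have "(k + e) * k \<le> k * (k - 1) + 1 + (q + 1) * (k - 1)"
      using q by (simp add: k algebra_simps)
    then show ?thesis
      using cyclic_vdw_chi_le_blocks[OF assms(1) that, of "q + 1"] by simp
  qed
  have counting: "cyclic_vdw_chi ((k + e) * k) k \<le> 3 + q"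
    if "((k + e) * k) ^ 2 \<le> (4 + e) ^ (k - 1)"
  proof -
    have "(4 + e) ^ (k - 1) \<le> (3 + q) ^ (k - 1)"
      using \<open>e < q\<close> by (intro power_mono) auto
    then show ?thesis
      using le_trans[OF that] \<open>3 \<le> k\<close> by (intro cyclic_vdw_chi_le_counting) auto
  qed
  \<comment> \<open>Counting settles \<open>k \<ge> 6\<close> and \<open>k = 5\<close>,
    \<open>e \<ge> 2\<close>; the other cases go to the block colouring.\<close>
  have "k = 3 \<or> k = 4 \<or> k = 5 \<or> 6 \<le> k" "e = 1 \<or> 2 \<le> e" "2 \<le> e \<Longrightarrow> e = 2 \<or> 3 \<le> e"
    using assms by linarith+
  then consider "k = 3" "e = 1" | "k = 3" "2 \<le> e" | "k = 4" "e = 1" | "k = 4" "e = 2" | "k = 4" "3 \<le> e"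
    | "k = 5" "e = 1" | "k = 5" "2 \<le> e" | "6 \<le> k"
    by blast
  then show ?thesis
  proof cases
    case 1
    then show ?thesis using blocks[of 12] run_free_small by simp
  next
    case 2
    then show ?thesis using blocks[of 13] run_free_small by simp
  next
    case 3
    then show ?thesis using blocks[of 20] run_free_small by simp
  next
    case 4
    then show ?thesis using blocks[of 24] run_free_small by simp
  next
    case 5
    then show ?thesis using blocks[of 25] run_free_small by simp
  next
    case 6
    then show ?thesis using blocks[of 30] run_free_small by simp
  next
    case 7
    then show ?thesis
      using counting square_le_power_5[of "4 + e"] by (simp add: algebra_simps)
  next
    case 8
    then have "k - 4 + (4 + e) = k + e"
      by simp
    then have "(k * (k + e)) ^ 2 \<le> (4 + e) ^ (k - 1)"
      using square_le_power[of k "4 + e"] 8 \<open>0 < e\<close> by simp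
    then show ?thesis
      by (intro counting) (simp only: mult.commute)
  qed
qed

theorem proposition4p5:
  fixes k m :: nat
  assumes "3 \<le> k" and "k < m"
  shows "2 \<le> cyclic_vdw_chi (m * k) k \<and>
         int (cyclic_vdw_chi (m * k) k)
           \<le> 3 + \<lceil>((real m - real k) * real k) / (real k - 1)\<rceil>"
proof
  show "2 \<le> cyclic_vdw_chi (m * k) k"
    using assms by (intro cyclic_vdw_chi_ge_2) auto
  define r where "r = (real m - real k) * real k / (real k - 1)"
  define q where "q = nat \<lceil>r\<rceil>"
  have "0 \<le> r"
    using assms by (simp add: r_def)
  then have q: "int q = \<lceil>r\<rceil>"
    by (simp add: q_def)
  then have "r \<le> real q"
    by linarith
  then have "real ((m - k) * k) \<le> real (q * (k - 1))"
    using assms by (simp add: r_def field_simps of_nat_diff)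
  then have "(m - k) * k \<le> q * (k - 1)"
    by (simp only: of_nat_le_iff)
  then have "cyclic_vdw_chi (m * k) k \<le> 3 + q"
    using cyclic_vdw_chi_upper[of k "m - k" q] assms by simp
  then show "int (cyclic_vdw_chi (m * k) k) \<le> 3 + \<lceil>((real m - real k) * real k) / (real k - 1)\<rceil>"
    using q unfolding r_def by linarith
qed

end
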